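(* For every $n\ge2$ there is an isomorphism of $k$-linear categories $$\mathcal{R}_n\xrightarrow{\ \sim\ }\mathcal{A}(-\mathcal{M}_n)$$ between Y. Tian's disk category $\mathcal{R}_n$ and the Heegaard-Floer category $\mathcal{A}(-\mathcal{M}_n)$ associated to the zig-zag arc diagram $\mathcal{M}_n$ of the disk with $2n$ boundary points.
   Context: $k$ is a field of characteristic $2$; $k$-linear categories are viewed as dg categories with $d=0$. The disk category $\mathcal{R}_n$: let $\mathcal{Q}_n$ be the quiver whose vertices are the subsets $S\subset\{1,\dots,n-1\}$ (written $e_S$, with $e_S=e_{i_1}\cdots e_{i_k}$ for $S=\{i_1<\dots<i_k\}$) and which has exactly one arrow $\theta_p:e_S\to e_T$ whenever $p,p+1\notin S$ and $T=S\cup\{p,p+1\}$ (so $|T|=|S|+2$), and no other arrows. $\mathcal{R}_n$ is the $k$-linear category generated by $\mathcal{Q}_n$ subject to $\theta_p\theta_q=\theta_q\theta_p$ for each pair of paths $\theta_p\theta_q,\theta_q\theta_p:e_S\to e_T$ in $\mathcal{Q}_n$. The category $\mathcal{A}(-\mathcal{M}_n)$ (with $d=0$): the zig-zag diagram $\mathcal{M}_n$ has $n$ line segments $\mathcal{Z}_1,\dots,\mathcal{Z}_n$ and $n-1$ one-handles $h_1,\dots,h_{n-1}$, with $h_i$ joining $\mathcal{Z}_i$ and $\mathcal{Z}_{i+1}$. Objects of $\mathcal{A}(-\mathcal{M}_n)$ are subsets $S\subset\{h_1,\dots,h_{n-1}\}$. There are basic Reeb chords $\rho_{i,j}:h_i\to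 h_j$ exactly when $i$ is odd, $j$ is even, $|i-j|=1$ and $1\le i,j\le n-1$; that is $h_1\to h_2\leftarrow h_3\to h_4\leftarrow\cdots$. The morphisms are generated by maps $S\to(S\setminus\{h_i\})\cup\{h_j\}$, one for each Reeb chord $\rho_{i,j}$ and each $S$ with $h_i\in S$, $h_j\notin S$; the only relations are that whenever two generators for chords $\rho_{i,j}$, $\rho_{i',j'}$ can be applied to $S$ in either order, the resulting square commutes. *)

theory Defs
  imports
    "HOL-Algebra.Algebraic_Closure_Type"
    "HOL-Library.Poly_Mapping"
    "Graph_Theory.Arc_Walk"
begin

section \<open>Linear categories\<close>

text \<open>
  The ground field is a type \<open>'k\<close> of class \<open>field\<close>; \<open>ring_of_type_algebra\<close> is the
  corresponding ring record. The composition \<open>cmp C x y z g f\<close> is \<open>g \<circ> f\<close> for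
  \<open>f : x \<rightarrow> y\<close> and \<open>g : y \<rightarrow> z\<close>. Hom-spaces of different pairs of objects need not be
  disjoint, so all operations on morphisms carry the objects as arguments. Only the additive
  and scalar structure of the record \<open>Hom C x y\<close> matters, not its fields \<open>mult\<close> and \<open>one\<close>.
\<close>

record ('o, 'm, 'k) lin_cat =
  Obj :: "'o set"
  Hom :: "'o \<Rightarrow> 'o \<Rightarrow> ('k, 'm) module"
  ident :: "'o \<Rightarrow> 'm"
  cmp :: "'o \<Rightarrow> 'o \<Rightarrow> 'o \<Rightarrow> 'm \<Rightarrow> 'm \<Rightarrow> 'm"

abbreviation Mor :: "('o, 'm, 'k) lin_cat \<Rightarrow> 'o \<Rightarrow> 'o \<Rightarrow> 'm set" where
  "Mor C x y \<equiv> carrier (Hom C x y)"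

locale linear_category =
  fixes C :: "('o, 'm, 'k :: field) lin_cat"
  assumes hom_module:
      "\<lbrakk>x \<in> Obj C; y \<in> Obj C\<rbrakk> \<Longrightarrow> Module.module (ring_of_type_algebra :: 'k ring) (Hom C x y)"
    and ident_mor: "x \<in> Obj C \<Longrightarrow> ident C x \<in> Mor C x x"
    and comp_mor:
      "\<lbrakk>x \<in> Obj C; y \<in> Obj C; z \<in> Obj C; f \<in> Mor C x y; g \<in> Mor C y z\<rbrakk>
        \<Longrightarrow> cmp C x y z g f \<in> Mor C x z"
    and comp_ident_right:
      "\<lbrakk>x \<in> Obj C; y \<in> Obj C; f \<in> Mor C x y\<rbrakk> \<Longrightarrow> cmp C x x y f (ident C x) = f"
    and comp_ident_left:
      "\<lbrakk>x \<in> Obj C; y \<in> Obj C; f \<in> Mor C x y\<rbrakk> \<Longrightarrow> cmp C x y y (ident C y) f = f"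
    and comp_assoc:
      "\<lbrakk>w \<in> Obj C; x \<in> Obj C; y \<in> Obj C; z \<in> Obj C;
        f \<in> Mor C w x; g \<in> Mor C x y; h \<in> Mor C y z\<rbrakk>
        \<Longrightarrow> cmp C w x z (cmp C x y z h g) f = cmp C w y z h (cmp C w x y g f)"
    and comp_add_left:
      "\<lbrakk>x \<in> Obj C; y \<in> Obj C; z \<in> Obj C; f \<in> Mor C x y; g \<in> Mor C y z; g' \<in> Mor C y z\<rbrakk>
        \<Longrightarrow> cmp C x y z (g \<oplus>\<^bsub>Hom C y z\<^esub> g') f
              = cmp C x y z g f \<oplus>\<^bsub>Hom C x z\<^esub> cmp C x y z g' f"
    and comp_add_right:
      "\<lbrakk>x \<in> Obj C; y \<in> Obj C; z \<in> Obj C; f \<in> Mor C x y; f' \<in> Mor C x y; g \<in> Mor C y z\<rbrakk>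
        \<Longrightarrow> cmp C x y z g (f \<oplus>\<^bsub>Hom C x y\<^esub> f')
              = cmp C x y z g f \<oplus>\<^bsub>Hom C x z\<^esub> cmp C x y z g f'"
    and comp_smult_left:
      "\<lbrakk>x \<in> Obj C; y \<in> Obj C; z \<in> Obj C; f \<in> Mor C x y; g \<in> Mor C y z\<rbrakk>
        \<Longrightarrow> cmp C x y z (c \<odot>\<^bsub>Hom C y z\<^esub> g) f = c \<odot>\<^bsub>Hom C x z\<^esub> cmp C x y z g f"
    and comp_smult_right:
      "\<lbrakk>x \<in> Obj C; y \<in> Obj C; z \<in> Obj C; f \<in> Mor C x y; g \<in> Mor C y z\<rbrakk>
        \<Longrightarrow> cmp C x y z g (c \<odot>\<^bsub>Hom C x y\<^esub> f) = c \<odot>\<^bsub>Hom C x z\<^esub> cmp C x y z g f"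

locale linear_functor = C: linear_category C + D: linear_category D
  for C :: "('o, 'm, 'k :: field) lin_cat" and D :: "('p, 'n, 'k) lin_cat" +
  fixes Fo :: "'o \<Rightarrow> 'p" and Fm :: "'o \<Rightarrow> 'o \<Rightarrow> 'm \<Rightarrow> 'n"
  assumes map_obj: "x \<in> Obj C \<Longrightarrow> Fo x \<in> Obj D"
    and map_mor:
      "\<lbrakk>x \<in> Obj C; y \<in> Obj C; f \<in> Mor C x y\<rbrakk> \<Longrightarrow> Fm x y f \<in> Mor D (Fo x) (Fo y)"
    and map_add:
      "\<lbrakk>x \<in> Obj C; y \<in> Obj C; f \<in> Mor C x y; g \<in> Mor C x y\<rbrakk>
        \<Longrightarrow> Fm x y (f \<oplus>\<^bsub>Hom C x y\<^esub> g) = Fm x y f \<oplus>\<^bsub>Hom D (Fo x) (Fo y)\<^esub> Fm x y g"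
    and map_smult:
      "\<lbrakk>x \<in> Obj C; y \<in> Obj C; f \<in> Mor C x y\<rbrakk>
        \<Longrightarrow> Fm x y (c \<odot>\<^bsub>Hom C x y\<^esub> f) = c \<odot>\<^bsub>Hom D (Fo x) (Fo y)\<^esub> Fm x y f"
    and map_ident: "x \<in> Obj C \<Longrightarrow> Fm x x (ident C x) = ident D (Fo x)"
    and map_comp:
      "\<lbrakk>x \<in> Obj C; y \<in> Obj C; z \<in> Obj C; f \<in> Mor C x y; g \<in> Mor C y z\<rbrakk>
        \<Longrightarrow> Fm x z (cmp C x y z g f)
              = cmp D (Fo x) (Fo y) (Fo z) (Fm y z g) (Fm x y f)"

definition isomorphic_lin_cat ::
    "('o, 'm, 'k :: field) lin_cat \<Rightarrow> ('p, 'n, 'k) lin_cat \<Rightarrow> bool" where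
  "isomorphic_lin_cat C D \<longleftrightarrow>
    (\<exists>Fo Fm Go Gm. linear_functor C D Fo Fm \<and> linear_functor D C Go Gm
      \<and> (\<forall>x \<in> Obj C. Go (Fo x) = x)
      \<and> (\<forall>x \<in> Obj D. Fo (Go x) = x)
      \<and> (\<forall>x \<in> Obj C. \<forall>y \<in> Obj C. \<forall>f \<in> Mor C x y. Gm (Fo x) (Fo y) (Fm x y f) = f)
      \<and> (\<forall>x \<in> Obj D. \<forall>y \<in> Obj D. \<forall>f \<in> Mor D x y. Fm (Go x) (Go y) (Gm x y f) = f))"

section \<open>Linear categories presented by a quiver with relations\<close>

text \<open>
  A quiver is a \<open>pre_digraph\<close>, and a path from \<open>u\<close> to \<open>v\<close> is an arc walk \<open>awalk u p v\<close>, listing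
  the arrows in the order in which they are traversed. The free linear category on \<open>Q\<close> has the
  finite linear combinations of paths as morphisms.
\<close>

definition path_conv :: "('a list \<Rightarrow>\<^sub>0 'k :: field) \<Rightarrow> ('a list \<Rightarrow>\<^sub>0 'k) \<Rightarrow> ('a list \<Rightarrow>\<^sub>0 'k)" where
  "path_conv f g = (\<Sum>p \<in> Poly_Mapping.keys f. \<Sum>q \<in> Poly_Mapping.keys g.
     Poly_Mapping.single (p @ q) (Poly_Mapping.lookup f p * Poly_Mapping.lookup g q))"

definition free_lin_cat ::
    "('v, 'a) pre_digraph \<Rightarrow> ('v, 'a list \<Rightarrow>\<^sub>0 'k :: field, 'k) lin_cat" where
  "free_lin_cat Q =
    \<lparr>Obj = verts Q,
     Hom = (\<lambda>u v. \<lparr>carrier = {f. \<forall>p \<in> Poly_Mapping.keys f. pre_digraph.awalk Q u p v},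
                   monoid.mult = undefined, one = undefined,
                   zero = 0, add = (+), module.smult = (\<lambda>c. Poly_Mapping.map ((*) c))\<rparr>),
     ident = (\<lambda>u. Poly_Mapping.single [] 1),
     cmp = (\<lambda>u v w g f. path_conv f g)\<rparr>"

text \<open>The two-sided ideal generated by a family of sets of morphisms.\<close>

inductive_set gen_ideal ::
    "('o, 'm, 'k) lin_cat \<Rightarrow> ('o \<Rightarrow> 'o \<Rightarrow> 'm set) \<Rightarrow> ('o \<times> 'o \<times> 'm) set"
  for C R where
  gen: "\<lbrakk>x \<in> Obj C; y \<in> Obj C; f \<in> R x y\<rbrakk> \<Longrightarrow> (x, y, f) \<in> gen_ideal C R"
| zero: "\<lbrakk>x \<in> Obj C; y \<in> Obj C\<rbrakk> \<Longrightarrow> (x, y, \<zero>\<^bsub>Hom C x y\<^esub>) \<in> gen_ideal C R"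
| add: "\<lbrakk>(x, y, f) \<in> gen_ideal C R; (x, y, g) \<in> gen_ideal C R\<rbrakk>
        \<Longrightarrow> (x, y, f \<oplus>\<^bsub>Hom C x y\<^esub> g) \<in> gen_ideal C R"
| smult: "(x, y, f) \<in> gen_ideal C R \<Longrightarrow> (x, y, c \<odot>\<^bsub>Hom C x y\<^esub> f) \<in> gen_ideal C R"
| comp_left: "\<lbrakk>(x, y, f) \<in> gen_ideal C R; z \<in> Obj C; g \<in> Mor C y z\<rbrakk>
        \<Longrightarrow> (x, z, cmp C x y z g f) \<in> gen_ideal C R"
| comp_right: "\<lbrakk>(y, z, g) \<in> gen_ideal C R; x \<in> Obj C; f \<in> Mor C x y\<rbrakk>
        \<Longrightarrow> (x, z, cmp C x y z g f) \<in> gen_ideal C R"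

definition ideal_at :: "('o \<times> 'o \<times> 'm) set \<Rightarrow> 'o \<Rightarrow> 'o \<Rightarrow> 'm set" where
  "ideal_at J x y = {f. (x, y, f) \<in> J}"

text \<open>
  The quotient of a linear category by an ideal: morphisms are additive cosets. As in
  \<open>rcoset_mult\<close> from \<open>HOL-Algebra\<close>, an operation on cosets is the union of the cosets of
  its values on representatives, which is a single coset.
\<close>

definition quot_lin_cat ::
    "('o, 'm, 'k) lin_cat \<Rightarrow> ('o \<times> 'o \<times> 'm) set \<Rightarrow> ('o, 'm set, 'k) lin_cat" where
  "quot_lin_cat C J =
    \<lparr>Obj = Obj C,
     Hom = (\<lambda>x y. \<lparr>carrier = a_rcosets\<^bsub>Hom C x y\<^esub> (ideal_at J x y),
                   monoid.mult = undefined, one = undefined,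
                   zero = ideal_at J x y, add = set_add (Hom C x y),
                   module.smult = (\<lambda>c A. \<Union>f \<in> A. ideal_at J x y +>\<^bsub>Hom C x y\<^esub> (c \<odot>\<^bsub>Hom C x y\<^esub> f))\<rparr>),
     ident = (\<lambda>x. ideal_at J x x +>\<^bsub>Hom C x x\<^esub> ident C x),
     cmp = (\<lambda>x y z B A. \<Union>g \<in> B. \<Union>f \<in> A. ideal_at J x z +>\<^bsub>Hom C x z\<^esub> cmp C x y z g f)\<rparr>"

text \<open>\<open>E u v\<close> is a set of pairs of paths from \<open>u\<close> to \<open>v\<close> which are to be identified.\<close>

definition presented_lin_cat ::
    "('v, 'a) pre_digraph \<Rightarrow> ('v \<Rightarrow> 'v \<Rightarrow> ('a list \<times> 'a list) set)
      \<Rightarrow> ('v, ('a list \<Rightarrow>\<^sub>0 'k :: field) set, 'k) lin_cat" where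
  "presented_lin_cat Q E =
    quot_lin_cat (free_lin_cat Q)
      (gen_ideal (free_lin_cat Q)
        (\<lambda>u v. {Poly_Mapping.single p 1 - Poly_Mapping.single q 1 | p q. (p, q) \<in> E u v}))"

section \<open>The disk category\<close>

text \<open>The vertex \<open>e\<^sub>S\<close> is \<open>S\<close> itself, and \<open>(S, p)\<close> is the arrow \<open>\<theta>\<^sub>p\<close> starting at \<open>e\<^sub>S\<close>.\<close>

definition disk_quiver :: "nat \<Rightarrow> (nat set, nat set \<times> nat) pre_digraph" where
  "disk_quiver n =
    \<lparr>verts = Pow {1..n - 1},
     arcs = {(S, p). S \<subseteq> {1..n - 1} \<and> {p, p + 1} \<subseteq> {1..n - 1} \<and> p \<notin> S \<and> p + 1 \<notin> S},
     tail = (\<lambda>(S, p). S),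
     head = (\<lambda>(S, p). S \<union> {p, p + 1})\<rparr>"

definition disk_relations ::
    "nat \<Rightarrow> nat set \<Rightarrow> nat set \<Rightarrow> ((nat set \<times> nat) list \<times> (nat set \<times> nat) list) set" where
  "disk_relations n S T =
    {([(S, p), (S \<union> {p, p + 1}, q)], [(S, q), (S \<union> {q, q + 1}, p)]) | p q.
       pre_digraph.awalk (disk_quiver n) S [(S, p), (S \<union> {p, p + 1}, q)] T \<and>
       pre_digraph.awalk (disk_quiver n) S [(S, q), (S \<union> {q, q + 1}, p)] T}"

definition disk_category ::
    "nat \<Rightarrow> (nat set, ((nat set \<times> nat) list \<Rightarrow>\<^sub>0 'k :: field) set, 'k) lin_cat" where
  "disk_category n = presented_lin_cat (disk_quiver n) (disk_relations n)"

section \<open>The category of the zig-zag arc diagram\<close>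

text \<open>
  The one-handle \<open>h\<^sub>i\<close> (\<open>1 \<le> i \<le> n - 1\<close>) joins the line segments \<open>Z\<^sub>i\<close> and \<open>Z\<^sub>i\<^sub>+\<^sub>1\<close>. Two
  different handles \<open>h\<^sub>i\<close>, \<open>h\<^sub>j\<close> thus meet a common segment iff \<open>\<bar>i - j\<bar> = 1\<close>, and with the
  orientation of the segments in \<open>-M\<^sub>n\<close> the Reeb chord between them leads from the odd
  to the even index.
\<close>

datatype handle = H nat

definition handles :: "nat \<Rightarrow> handle set" where
  "handles n = H ` {1..n - 1}"

definition reeb_chords :: "nat \<Rightarrow> (handle \<times> handle) set" where
  "reeb_chords n =
    {(H i, H j) | i j. i \<in> {1..n - 1} \<and> j \<in> {1..n - 1} \<and> odd i \<and> even j
       \<and> \<bar>int i - int j\<bar> = 1}"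

text \<open>\<open>move a b S\<close> is the target of the generator given by the Reeb chord from \<open>a\<close> to \<open>b\<close>.\<close>

definition move :: "handle \<Rightarrow> handle \<Rightarrow> handle set \<Rightarrow> handle set" where
  "move a b S = (S - {a}) \<union> {b}"

definition zigzag_quiver :: "nat \<Rightarrow> (handle set, handle set \<times> handle \<times> handle) pre_digraph" where
  "zigzag_quiver n =
    \<lparr>verts = Pow (handles n),
     arcs = {(S, a, b). S \<subseteq> handles n \<and> (a, b) \<in> reeb_chords n \<and> a \<in> S \<and> b \<notin> S},
     tail = (\<lambda>(S, a, b). S),
     head = (\<lambda>(S, a, b). move a b S)\<rparr>"

definition zigzag_relations ::
    "nat \<Rightarrow> handle set \<Rightarrow> handle set
      \<Rightarrow> ((handle set \<times> handle \<times> handle) list \<times> (handle set \<times> handle \<times> handle) list) set" where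
  "zigzag_relations n S T =
    {([(S, a, b), (move a b S, a', b')], [(S, a', b'), (move a' b' S, a, b)]) | a b a' b'.
       pre_digraph.awalk (zigzag_quiver n) S [(S, a, b), (move a b S, a', b')] T \<and>
       pre_digraph.awalk (zigzag_quiver n) S [(S, a', b'), (move a' b' S, a, b)] T}"

definition zigzag_category ::
    "nat \<Rightarrow> (handle set, ((handle set \<times> handle \<times> handle) list \<Rightarrow>\<^sub>0 'k :: field) set, 'k) lin_cat"
  where
  "zigzag_category n = presented_lin_cat (zigzag_quiver n) (zigzag_relations n)"

end

(* The map of vertices sending S to the set of handles h_i with (i in S iff i even), i.e. the
   symmetric difference of S with the odd indices, turns "adjoin p and p + 1" into "replace the odd
   one of h_p, h_(p+1) by the even one". It is an isomorphism of quivers which matches the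
   commutation relations, and an isomorphism of quivers with relations induces an isomorphism of
   the presented linear categories. *)
theory Submission
  imports Defs
begin

section \<open>Quotients of linear categories\<close>

text \<open>The hom-spaces are spaces of cosets, and every operation on them is a union over
  representatives, so the obstacle is independence of representatives. It is settled once for
  abstract ideals. Bases of the quotients are never computed, and bijectivity on cosets is never
  proved directly: the two mutually inverse quiver maps both go through the same construction, each
  carries the generators of one ideal to generators of the other, and that the functors are inverse
  is checked on representatives in the free categories.

  The relations match because the chord attached to \<open>\<theta>_p\<close> depends on
  \<open>p\<close> alone and not on the vertex where the arrow starts. Hence two arrows applied in
  the opposite order become two chords applied in the opposite order, and a square goes to a
  square.\<close>

lemma ring_of_type_algebra_simps [simp]:
  "carrier (ring_of_type_algebra :: 'k :: field ring) = UNIV"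
  "monoid.mult (ring_of_type_algebra :: 'k ring) = (*)"
  "monoid.one (ring_of_type_algebra :: 'k ring) = 1"
  "ring.add (ring_of_type_algebra :: 'k ring) = (+)"
  by (simp_all add: ring_of_type_algebra_def)

text \<open>Collapses the unions that define operations on cosets, once all representatives are
  known to give the same coset. The element \<open>a\<close> guarantees that the union is not
  empty.\<close>

lemma UN_eq_const:
  assumes "a \<in> A" "\<And>x. x \<in> A \<Longrightarrow> F x = B"
  shows "(\<Union>x \<in> A. F x) = B"
  using assms by auto

text \<open>Only closure properties are recorded, so the quotient construction does not depend on
  how an ideal is generated.\<close>

locale linear_ideal = linear_category C
  for C :: "('o, 'm, 'k :: field) lin_cat" +
  fixes J :: "('o \<times> 'o \<times> 'm) set"
  assumes ideal_mor: "(x, y, f) \<in> J \<Longrightarrow> x \<in> Obj C \<and> y \<in> Obj C \<and> f \<in> Mor C x y"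
    and ideal_zero: "\<lbrakk>x \<in> Obj C; y \<in> Obj C\<rbrakk> \<Longrightarrow> (x, y, \<zero>\<^bsub>Hom C x y\<^esub>) \<in> J"
    and ideal_add:
      "\<lbrakk>(x, y, f) \<in> J; (x, y, g) \<in> J\<rbrakk> \<Longrightarrow> (x, y, f \<oplus>\<^bsub>Hom C x y\<^esub> g) \<in> J"
    and ideal_smult: "(x, y, f) \<in> J \<Longrightarrow> (x, y, c \<odot>\<^bsub>Hom C x y\<^esub> f) \<in> J"
    and ideal_comp_left:
      "\<lbrakk>(x, y, f) \<in> J; z \<in> Obj C; g \<in> Mor C y z\<rbrakk> \<Longrightarrow> (x, z, cmp C x y z g f) \<in> J"
    and ideal_comp_right:
      "\<lbrakk>(y, z, g) \<in> J; x \<in> Obj C; f \<in> Mor C x y\<rbrakk> \<Longrightarrow> (x, z, cmp C x y z g f) \<in> J"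
begin

abbreviation coset :: "'o \<Rightarrow> 'o \<Rightarrow> 'm \<Rightarrow> 'm set" where
  "coset x y f \<equiv> ideal_at J x y +>\<^bsub>Hom C x y\<^esub> f"

lemma hom_abelian_group:
  assumes "x \<in> Obj C" "y \<in> Obj C"
  shows "abelian_group (Hom C x y)"
proof -
  interpret Module.module "ring_of_type_algebra :: 'k ring" "Hom C x y"
    using assms by (rule hom_module)
  show ?thesis by unfold_locales
qed

lemma ideal_at_subgroup:
  assumes "x \<in> Obj C" "y \<in> Obj C"
  shows "abelian_subgroup (ideal_at J x y) (Hom C x y)"
proof -
  interpret M: Module.module "ring_of_type_algebra :: 'k ring" "Hom C x y"
    using assms by (rule hom_module)
  \<comment> \<open>Closure of the ideal under additive inverses comes from its closure under the
    scalar \<open>- 1\<close>.\<close>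
  have minus: "\<ominus>\<^bsub>Hom C x y\<^esub> f = (- 1) \<odot>\<^bsub>Hom C x y\<^esub> f" if "f \<in> Mor C x y" for f
  proof -
    have "((- 1) \<odot>\<^bsub>Hom C x y\<^esub> f) \<oplus>\<^bsub>Hom C x y\<^esub> f = \<zero>\<^bsub>Hom C x y\<^esub>"
      using M.smult_l_distr[of "- 1" 1 f] M.smult_l_null[of f] M.smult_one[of f] that
      by (simp add: ring_of_type_algebra_def)
    then show ?thesis
      using that M.M.minus_equality M.smult_closed by auto
  qed
  show ?thesis
  proof (intro abelian_subgroupI3 additive_subgroup.intro M.M.a_group group.subgroupI)
    show "ideal_at J x y \<subseteq> carrier (add_monoid (Hom C x y))"
      using ideal_mor by (auto simp: ideal_at_def)
    show "ideal_at J x y \<noteq> {}"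
      using ideal_zero[OF assms] by (auto simp: ideal_at_def)
    show "inv\<^bsub>add_monoid (Hom C x y)\<^esub> a \<in> ideal_at J x y" if "a \<in> ideal_at J x y" for a
      using that minus[of a] ideal_mor ideal_smult[of x y a "- 1"]
      by (auto simp: ideal_at_def a_inv_def)
    show "a \<otimes>\<^bsub>add_monoid (Hom C x y)\<^esub> b \<in> ideal_at J x y"
      if "a \<in> ideal_at J x y" "b \<in> ideal_at J x y" for a b
      using that ideal_add by (auto simp: ideal_at_def)
    show "abelian_group (Hom C x y)" by unfold_locales
  qed
qed

lemma coset_memE:
  assumes "f' \<in> coset x y f"
  obtains j where "(x, y, j) \<in> J" "f' = j \<oplus>\<^bsub>Hom C x y\<^esub> f"
  using assms by (auto simp: a_r_coset_def' ideal_at_def)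

lemma coset_self:
  "\<lbrakk>x \<in> Obj C; y \<in> Obj C; f \<in> Mor C x y\<rbrakk> \<Longrightarrow> f \<in> coset x y f"
  by (simp add: abelian_subgroup.a_rcos_self ideal_at_subgroup)

lemma coset_mem_mor:
  "\<lbrakk>x \<in> Obj C; y \<in> Obj C; f \<in> Mor C x y; f' \<in> coset x y f\<rbrakk> \<Longrightarrow> f' \<in> Mor C x y"
  by (meson abelian_subgroup.a_elemrcos_carrier ideal_at_subgroup)

text \<open>The form in which independence of representatives is used below: an error term from the
  ideal may be dropped.\<close>

lemma coset_absorb:
  assumes "(x, y, j) \<in> J" "f \<in> Mor C x y"
  shows "coset x y (j \<oplus>\<^bsub>Hom C x y\<^esub> f) = coset x y f"
proof -
  have xy: "x \<in> Obj C" "y \<in> Obj C" using ideal_mor assms(1) by auto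
  have "j \<oplus>\<^bsub>Hom C x y\<^esub> f \<in> coset x y f"
    using assms(1) by (auto simp: a_r_coset_def' ideal_at_def)
  then show ?thesis
    using abelian_subgroup.a_repr_independence'[OF ideal_at_subgroup[OF xy]] assms(2) by simp
qed

lemma coset_add:
  "\<lbrakk>x \<in> Obj C; y \<in> Obj C; f \<in> Mor C x y; g \<in> Mor C x y\<rbrakk>
    \<Longrightarrow> coset x y f \<oplus>\<^bsub>Hom (quot_lin_cat C J) x y\<^esub> coset x y g
      = coset x y (f \<oplus>\<^bsub>Hom C x y\<^esub> g)"
  by (simp add: quot_lin_cat_def abelian_subgroup.a_rcos_sum ideal_at_subgroup)

lemma coset_zero:
  assumes "x \<in> Obj C" "y \<in> Obj C"
  shows "\<zero>\<^bsub>Hom (quot_lin_cat C J) x y\<^esub> = coset x y \<zero>\<^bsub>Hom C x y\<^esub>"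
  using abelian_subgroup.a_rcos_const[OF ideal_at_subgroup[OF assms]] ideal_zero[OF assms]
  by (simp add: quot_lin_cat_def ideal_at_def)

lemma coset_smult:
  assumes "x \<in> Obj C" "y \<in> Obj C" "f \<in> Mor C x y"
  shows "c \<odot>\<^bsub>Hom (quot_lin_cat C J) x y\<^esub> coset x y f = coset x y (c \<odot>\<^bsub>Hom C x y\<^esub> f)"
proof -
  interpret M: Module.module "ring_of_type_algebra :: 'k ring" "Hom C x y"
    using assms(1,2) by (rule hom_module)
  have "coset x y (c \<odot>\<^bsub>Hom C x y\<^esub> f') = coset x y (c \<odot>\<^bsub>Hom C x y\<^esub> f)"
    if f': "f' \<in> coset x y f" for f'
  proof -
    obtain j where j: "(x, y, j) \<in> J" "f' = j \<oplus>\<^bsub>Hom C x y\<^esub> f"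
      using f' by (rule coset_memE)
    then have "c \<odot>\<^bsub>Hom C x y\<^esub> f' = (c \<odot>\<^bsub>Hom C x y\<^esub> j) \<oplus>\<^bsub>Hom C x y\<^esub> (c \<odot>\<^bsub>Hom C x y\<^esub> f)"
      using M.smult_r_distr[of c j f] ideal_mor assms(3) by auto
    then show ?thesis
      using coset_absorb[OF ideal_smult[OF j(1)]] assms(3) M.smult_closed by simp
  qed
  then show ?thesis
    unfolding quot_lin_cat_def lin_cat.simps module.simps
    by (intro UN_eq_const[OF coset_self[OF assms]])
qed

text \<open>The two factors are replaced one at a time. With \<open>g' = k + g\<close> and
  \<open>f' = j + f\<close>, the errors are \<open>k\<close> composed with \<open>f'\<close> and
  \<open>g\<close> composed with \<open>j\<close>; both lie in the ideal because it is
  two-sided.\<close>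

lemma coset_cmp:
  assumes o: "x \<in> Obj C" "y \<in> Obj C" "z \<in> Obj C" and f: "f \<in> Mor C x y" and g: "g \<in> Mor C y z"
  shows "cmp (quot_lin_cat C J) x y z (coset y z g) (coset x y f) = coset x z (cmp C x y z g f)"
proof -
  have "coset x z (cmp C x y z g' f') = coset x z (cmp C x y z g f)"
    if g': "g' \<in> coset y z g" and f': "f' \<in> coset x y f" for g' f'
  proof -
    obtain j where j: "(x, y, j) \<in> J" "f' = j \<oplus>\<^bsub>Hom C x y\<^esub> f"
      using f' by (rule coset_memE)
    obtain k where k: "(y, z, k) \<in> J" "g' = k \<oplus>\<^bsub>Hom C y z\<^esub> g"
      using g' by (rule coset_memE)
    have m: "f' \<in> Mor C x y" "j \<in> Mor C x y" "k \<in> Mor C y z"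
      using coset_mem_mor o f f' j(1) k(1) ideal_mor by blast+
    have "coset x z (cmp C x y z g' f') = coset x z (cmp C x y z g f')"
      using coset_absorb[OF ideal_comp_right[OF k(1) o(1) m(1)]] comp_mor[OF o m(1) g]
        comp_add_left[OF o m(1) m(3) g] k(2) by simp
    also have "\<dots> = coset x z (cmp C x y z g f)"
      using coset_absorb[OF ideal_comp_left[OF j(1) o(3) g]] comp_mor[OF o f g]
        comp_add_right[OF o m(2) f g] j(2) by simp
    finally show ?thesis .
  qed
  then show ?thesis
    unfolding quot_lin_cat_def lin_cat.simps
    by (intro UN_eq_const[OF coset_self[OF o(2,3) g]] UN_eq_const[OF coset_self[OF o(1,2) f]])
qed

lemma quot_simps:
  "Obj (quot_lin_cat C J) = Obj C"
  "ident (quot_lin_cat C J) x = coset x x (ident C x)"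
  by (simp_all add: quot_lin_cat_def)

lemma quot_Mor: "Mor (quot_lin_cat C J) x y = coset x y ` Mor C x y"
  by (auto simp: quot_lin_cat_def A_RCOSETS_def')

lemma quot_hom_module:
  assumes o: "x \<in> Obj C" "y \<in> Obj C"
  shows "Module.module (ring_of_type_algebra :: 'k ring) (Hom (quot_lin_cat C J) x y)"
proof -
  interpret M: Module.module "ring_of_type_algebra :: 'k ring" "Hom C x y"
    using o by (rule hom_module)
  note [simp] = coset_add[OF o] coset_smult[OF o] coset_zero[OF o] o
  have smult_closed: "c \<odot>\<^bsub>Hom C x y\<^esub> f \<in> Mor C x y" if "f \<in> Mor C x y" for c f
    using M.smult_closed[of c f] that by simp
  show ?thesis
  proof (rule moduleI)
    show "cring (ring_of_type_algebra :: 'k ring)" by (rule M.R.is_cring)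
    show "abelian_group (Hom (quot_lin_cat C J) x y)"
    proof (rule abelian_groupI)
      fix A assume "A \<in> Mor (quot_lin_cat C J) x y"
      then obtain f where f: "f \<in> Mor C x y" "A = coset x y f" by (auto simp: quot_Mor)
      then show "\<exists>B \<in> Mor (quot_lin_cat C J) x y.
          B \<oplus>\<^bsub>Hom (quot_lin_cat C J) x y\<^esub> A = \<zero>\<^bsub>Hom (quot_lin_cat C J) x y\<^esub>"
        by (intro bexI[of _ "coset x y (\<ominus>\<^bsub>Hom C x y\<^esub> f)"]) (auto simp: quot_Mor M.M.l_neg)
    qed (auto simp: quot_Mor M.M.a_ac)
  qed (use M.smult_l_distr M.smult_r_distr M.smult_assoc1 M.smult_one in
      \<open>auto simp: quot_Mor smult_closed\<close>)
qed

text \<open>By \<open>quot_Mor\<close> every morphism is the coset of a representative, and the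
  coset rules pull each axiom back to the same axiom of \<open>C\<close>.\<close>

lemma quot_linear_category: "linear_category (quot_lin_cat C J)"
proof (rule linear_category.intro)
  fix x y assume "x \<in> Obj (quot_lin_cat C J)" "y \<in> Obj (quot_lin_cat C J)"
  then show "Module.module (ring_of_type_algebra :: 'k ring) (Hom (quot_lin_cat C J) x y)"
    by (simp add: quot_simps quot_hom_module)
qed (auto simp: quot_Mor coset_add coset_smult coset_cmp quot_simps ident_mor comp_mor
    abelian_monoid.a_closed[OF abelian_group.axioms(1)[OF hom_abelian_group]]
    Module.module.smult_closed[OF hom_module]
    comp_ident_left comp_ident_right comp_assoc
    comp_add_left comp_add_right comp_smult_left comp_smult_right)

end

section \<open>Functors induced on quotients\<close>

definition quot_map ::
    "('p, 'n, 'k) lin_cat \<Rightarrow> ('p \<times> 'p \<times> 'n) set \<Rightarrow> ('o \<Rightarrow> 'p) \<Rightarrow> ('o \<Rightarrow> 'o \<Rightarrow> 'm \<Rightarrow> 'n)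
      \<Rightarrow> 'o \<Rightarrow> 'o \<Rightarrow> 'm set \<Rightarrow> 'n set" where
  "quot_map D K Fo Fm x y A =
    (\<Union>f \<in> A. ideal_at K (Fo x) (Fo y) +>\<^bsub>Hom D (Fo x) (Fo y)\<^esub> Fm x y f)"

locale ideal_functor = linear_functor C D Fo Fm + C: linear_ideal C J + D: linear_ideal D K
  for C :: "('o, 'm, 'k :: field) lin_cat" and D :: "('p, 'n, 'k) lin_cat" and Fo Fm J K +
  assumes map_ideal: "(x, y, f) \<in> J \<Longrightarrow> (Fo x, Fo y, Fm x y f) \<in> K"
begin

lemma quot_map_coset:
  assumes o: "x \<in> Obj C" "y \<in> Obj C" and f: "f \<in> Mor C x y"
  shows "quot_map D K Fo Fm x y (C.coset x y f) = D.coset (Fo x) (Fo y) (Fm x y f)"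
proof -
  have "D.coset (Fo x) (Fo y) (Fm x y f') = D.coset (Fo x) (Fo y) (Fm x y f)"
    if f': "f' \<in> C.coset x y f" for f'
  proof -
    obtain j where j: "(x, y, j) \<in> J" "f' = j \<oplus>\<^bsub>Hom C x y\<^esub> f"
      using f' by (rule C.coset_memE)
    then show ?thesis
      using D.coset_absorb[OF map_ideal[OF j(1)] map_mor[OF o f]] C.ideal_mor[OF j(1)] map_add o f
      by simp
  qed
  then show ?thesis
    unfolding quot_map_def by (rule UN_eq_const[OF C.coset_self[OF o f]])
qed

lemma quot_functor:
  "linear_functor (quot_lin_cat C J) (quot_lin_cat D K) Fo (quot_map D K Fo Fm)"
proof (intro linear_functor.intro C.quot_linear_category D.quot_linear_category
    linear_functor_axioms.intro)
qed (auto simp: C.quot_Mor D.quot_Mor C.quot_simps D.quot_simps C.coset_add D.coset_add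
    C.coset_smult D.coset_smult C.coset_cmp D.coset_cmp quot_map_coset map_obj map_mor map_add
    map_smult map_ident map_comp C.ident_mor C.comp_mor
    abelian_monoid.a_closed[OF abelian_group.axioms(1)[OF C.hom_abelian_group]]
    Module.module.smult_closed[OF C.hom_module])

end

text \<open>Having both functors respect the ideals replaces a computation of the preimage of
  \<open>K\<close>: each functor descends by itself, and the inverse laws are inherited from
  representatives.\<close>

lemma isomorphic_quot:
  fixes C :: "('o, 'm, 'k :: field) lin_cat" and D :: "('p, 'n, 'k) lin_cat"
  assumes "ideal_functor C D Fo Fm J K" "ideal_functor D C Go Gm K J"
    and obj: "\<And>x. x \<in> Obj C \<Longrightarrow> Go (Fo x) = x" "\<And>x. x \<in> Obj D \<Longrightarrow> Fo (Go x) = x"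
    and mor:
      "\<And>x y f. \<lbrakk>x \<in> Obj C; y \<in> Obj C; f \<in> Mor C x y\<rbrakk> \<Longrightarrow> Gm (Fo x) (Fo y) (Fm x y f) = f"
      "\<And>x y f. \<lbrakk>x \<in> Obj D; y \<in> Obj D; f \<in> Mor D x y\<rbrakk> \<Longrightarrow> Fm (Go x) (Go y) (Gm x y f) = f"
  shows "isomorphic_lin_cat (quot_lin_cat C J) (quot_lin_cat D K)"
proof -
  interpret F: ideal_functor C D Fo Fm J K by fact
  interpret G: ideal_functor D C Go Gm K J by fact
  show ?thesis
    unfolding isomorphic_lin_cat_def
    by (intro exI[of _ Fo] exI[of _ Go] exI[of _ "quot_map D K Fo Fm"]
        exI[of _ "quot_map C J Go Gm"])
      (auto simp: F.quot_functor G.quot_functor F.C.quot_simps F.D.quot_simps F.C.quot_Mor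
        F.D.quot_Mor F.quot_map_coset G.quot_map_coset F.map_obj G.map_obj F.map_mor G.map_mor
        obj mor)
qed

section \<open>Ideals generated by relations\<close>

lemma gen_ideal_linear_ideal:
  fixes C :: "('o, 'm, 'k :: field) lin_cat"
  assumes "linear_category C"
    and R: "\<And>x y. \<lbrakk>x \<in> Obj C; y \<in> Obj C\<rbrakk> \<Longrightarrow> R x y \<subseteq> Mor C x y"
  shows "linear_ideal C (gen_ideal C R)"
proof -
  interpret linear_category C by fact
  show ?thesis
  proof (unfold_locales)
    \<comment> \<open>Only membership in the hom-spaces needs an induction; the closure conditions
      are the introduction rules of \<open>gen_ideal\<close>.\<close>
    fix x y f assume "(x, y, f) \<in> gen_ideal C R"
    then show "x \<in> Obj C \<and> y \<in> Obj C \<and> f \<in> Mor C x y"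
    proof (induction x y f)
      case (gen x y f)
      then show ?case using R by auto
    next
      case o: (zero x y)
      then interpret Module.module "ring_of_type_algebra :: 'k ring" "Hom C x y"
        by (rule hom_module)
      show ?case using o by simp
    next
      case (add x y f g)
      then have "x \<in> Obj C" "y \<in> Obj C" by auto
      then interpret Module.module "ring_of_type_algebra :: 'k ring" "Hom C x y"
        by (rule hom_module)
      show ?case using add by simp
    next
      case (smult x y f c)
      then have "x \<in> Obj C" "y \<in> Obj C" by auto
      then interpret Module.module "ring_of_type_algebra :: 'k ring" "Hom C x y"
        by (rule hom_module)
      show ?case using smult smult_closed[of c f] by simp
    qed (auto intro: comp_mor)
  qed (auto intro: gen_ideal.intros)
qed

text \<open>Additivity gives \<open>F 0 = F 0 + F 0\<close>, and one summand cancels. This serves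
  the zero rule in the next induction.\<close>

lemma linear_functor_map_zero:
  fixes C :: "('o, 'm, 'k :: field) lin_cat"
  assumes "linear_functor C D Fo Fm" and o: "x \<in> Obj C" "y \<in> Obj C"
  shows "Fm x y \<zero>\<^bsub>Hom C x y\<^esub> = \<zero>\<^bsub>Hom D (Fo x) (Fo y)\<^esub>"
proof -
  interpret linear_functor C D Fo Fm by fact
  interpret M: Module.module "ring_of_type_algebra :: 'k ring" "Hom C x y"
    using o by (rule C.hom_module)
  interpret N: Module.module "ring_of_type_algebra :: 'k ring" "Hom D (Fo x) (Fo y)"
    using o map_obj by (intro D.hom_module) auto
  show ?thesis
    using map_add[OF o M.M.zero_closed M.M.zero_closed] map_mor[OF o M.M.zero_closed]
    by (simp add: N.M.add.l_cancel_one')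
qed

text \<open>A linear functor turns each closure rule of the generated ideal into the same rule in
  the target, so only generators have to be compared.\<close>

lemma (in linear_functor) map_gen_ideal:
  assumes "(x, y, f) \<in> gen_ideal C R"
    and R: "\<And>x y. \<lbrakk>x \<in> Obj C; y \<in> Obj C\<rbrakk> \<Longrightarrow> R x y \<subseteq> Mor C x y"
    and RR': "\<And>x y f. \<lbrakk>x \<in> Obj C; y \<in> Obj C; f \<in> R x y\<rbrakk> \<Longrightarrow> Fm x y f \<in> R' (Fo x) (Fo y)"
  shows "(Fo x, Fo y, Fm x y f) \<in> gen_ideal D R'"
proof -
  interpret I: linear_ideal C "gen_ideal C R"
    using C.linear_category_axioms R by (rule gen_ideal_linear_ideal)
  show ?thesis
    using assms(1)
  proof (induction x y f)
    case (gen x y f)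
    then show ?case by (intro gen_ideal.gen map_obj RR')
  next
    case (zero x y)
    then show ?case by (simp add: linear_functor_map_zero[OF linear_functor_axioms] map_obj gen_ideal.zero)
  next
    case (add x y f g)
    then show ?case using I.ideal_mor[OF add(1)] I.ideal_mor[OF add(2)]
      by (simp add: map_add gen_ideal.add)
  next
    case (smult x y f c)
    then show ?case using I.ideal_mor[OF smult(1)] by (simp add: map_smult gen_ideal.smult)
  next
    case (comp_left x y f z g)
    then show ?case using I.ideal_mor[OF comp_left(1)]
      by (simp add: map_comp gen_ideal.comp_left map_obj map_mor)
  next
    case (comp_right y z g x f)
    then show ?case using I.ideal_mor[OF comp_right(1)]
      by (simp add: map_comp gen_ideal.comp_right map_obj map_mor)
  qed
qed

section \<open>Free linear categories\<close>

text \<open>Tailored to additive statements: a linear or multilinear identity reduces to single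
  paths.\<close>

lemma poly_mapping_single_plus_induct [case_names zero single_plus]:
  assumes "P 0" "\<And>p a f. P f \<Longrightarrow> P (Poly_Mapping.single p a + f)"
  shows "P f"
proof (induction f rule: update_induct)
  case const
  show ?case by fact
next
  case (update f a b)
  \<comment> \<open>The key \<open>a\<close> is new, so overwriting its coefficient is the same as
    adding a term.\<close>
  have "Poly_Mapping.update a b f = Poly_Mapping.single a b + f"
    using update(1)
    by (intro poly_mapping_eqI)
      (auto simp: lookup_update lookup_add lookup_single when_def in_keys_iff)
  with assms(2)[OF update(3)] show ?case by simp
qed

lemma path_conv_zero [simp]: "path_conv 0 g = 0" "path_conv f 0 = 0"
  by (simp_all add: path_conv_def)

lemma path_conv_single [simp]:
  "path_conv (Poly_Mapping.single p a) (Poly_Mapping.single q b)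
    = Poly_Mapping.single (p @ q) (a * b)"
  by (simp add: path_conv_def)

text \<open>Terms may cancel in \<open>f + f'\<close>, so the sums have different index sets. This
  is harmless because the summand is additive in the coefficient and vanishes at coefficient
  0.\<close>

lemma path_conv_add_left: "path_conv (f + f') g = path_conv f g + path_conv f' g"
  unfolding path_conv_def
  by (rule setsum_keys_plus_distrib) (simp_all add: algebra_simps single_add sum.distrib)

lemma path_conv_add_right: "path_conv f (g + g') = path_conv f g + path_conv f g'"
  unfolding path_conv_def sum.distrib[symmetric]
  by (intro sum.cong refl setsum_keys_plus_distrib) (simp_all add: algebra_simps single_add)

lemmas path_conv_add = path_conv_add_left path_conv_add_right

lemma lookup_map_mult:
  "Poly_Mapping.lookup (Poly_Mapping.map ((*) (c :: 'k :: field)) f) p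
    = c * Poly_Mapping.lookup f p"
  by (simp add: map.rep_eq when_def)

lemma map_mult_zero [simp]: "Poly_Mapping.map ((*) (c :: 'k :: field)) 0 = 0"
  by (intro poly_mapping_eqI) (simp add: lookup_map_mult)

lemma map_mult_add [simp]:
  "Poly_Mapping.map ((*) (c :: 'k :: field)) (f + g)
    = Poly_Mapping.map ((*) c) f + Poly_Mapping.map ((*) c) g"
  by (intro poly_mapping_eqI) (simp add: lookup_map_mult lookup_add algebra_simps)

text \<open>Both sides are trilinear. Three nested inductions reduce to single paths, where
  associativity of \<open>@\<close> and of the field multiplication remain.\<close>

lemma path_conv_assoc: "path_conv (path_conv f g) h = path_conv f (path_conv g h)"
proof (induction f rule: poly_mapping_single_plus_induct)
  case (single_plus p a f)
  have "path_conv (path_conv (Poly_Mapping.single p a) g) h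
      = path_conv (Poly_Mapping.single p a) (path_conv g h)"
  proof (induction g rule: poly_mapping_single_plus_induct)
    case (single_plus q b g)
    have "path_conv (path_conv (Poly_Mapping.single p a) (Poly_Mapping.single q b)) h
        = path_conv (Poly_Mapping.single p a) (path_conv (Poly_Mapping.single q b) h)"
      by (induction h rule: poly_mapping_single_plus_induct)
        (simp_all add: path_conv_add mult.assoc)
    with single_plus show ?case by (simp only: path_conv_add)
  qed simp
  with single_plus show ?case by (simp only: path_conv_add)
qed simp

lemma path_conv_Nil_left [simp]: "path_conv (Poly_Mapping.single [] 1) f = f"
  by (induction f rule: poly_mapping_single_plus_induct) (simp_all add: path_conv_add)

lemma path_conv_Nil_right [simp]: "path_conv f (Poly_Mapping.single [] 1) = f"
  by (induction f rule: poly_mapping_single_plus_induct) (simp_all add: path_conv_add)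

lemma path_conv_smult_left:
  "path_conv (Poly_Mapping.map ((*) c) f) g = Poly_Mapping.map ((*) c) (path_conv f g)"
proof (induction f rule: poly_mapping_single_plus_induct)
  case (single_plus p a f)
  have "path_conv (Poly_Mapping.single p (c * a)) g
      = Poly_Mapping.map ((*) c) (path_conv (Poly_Mapping.single p a) g)"
    by (induction g rule: poly_mapping_single_plus_induct)
      (simp_all add: path_conv_add mult.assoc)
  with single_plus show ?case by (simp add: path_conv_add)
qed simp

lemma path_conv_smult_right:
  "path_conv f (Poly_Mapping.map ((*) c) g) = Poly_Mapping.map ((*) c) (path_conv f g)"
proof (induction f rule: poly_mapping_single_plus_induct)
  case (single_plus p a f)
  have "path_conv (Poly_Mapping.single p a) (Poly_Mapping.map ((*) c) g)
      = Poly_Mapping.map ((*) c) (path_conv (Poly_Mapping.single p a) g)"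
    by (induction g rule: poly_mapping_single_plus_induct)
      (simp_all add: path_conv_add mult.left_commute)
  with single_plus show ?case by (simp add: path_conv_add)
qed simp

text \<open>Used to see that composites are again combinations of walks. Coefficients may cancel, so
  only this direction is available.\<close>

lemma keys_path_conv:
  assumes "r \<in> Poly_Mapping.keys (path_conv f g)"
  obtains p q where "r = p @ q" "p \<in> Poly_Mapping.keys f" "q \<in> Poly_Mapping.keys g"
proof -
  have "r \<in> (\<Union>p \<in> Poly_Mapping.keys f. \<Union>q \<in> Poly_Mapping.keys g. {p @ q})"
    using assms unfolding path_conv_def
    by (elim rev_subsetD) (intro order.trans[OF keys_sum] UN_mono order_refl; simp)+
  then show ?thesis using that by auto
qed

lemma keys_map_mult:
  "Poly_Mapping.keys (Poly_Mapping.map ((*) (c :: 'k :: field)) f) \<subseteq> Poly_Mapping.keys f"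
  by (auto simp: in_keys_iff lookup_map_mult)

context pre_digraph
begin

lemma cas_append: "cas u p v \<Longrightarrow> cas v q w \<Longrightarrow> cas u (p @ q) w"
  by (induction u p v rule: cas.induct) auto

lemma awalk_append: "awalk u p v \<Longrightarrow> awalk v q w \<Longrightarrow> awalk u (p @ q) w"
  by (auto simp: awalk_def cas_append simp del: cas_append_iff)

end

lemma free_lin_cat_simps [simp]:
  "Obj (free_lin_cat Q) = verts Q"
  "f \<in> Mor (free_lin_cat Q) u v
    \<longleftrightarrow> (\<forall>p \<in> Poly_Mapping.keys f. pre_digraph.awalk Q u p v)"
  "\<zero>\<^bsub>Hom (free_lin_cat Q) u v\<^esub> = 0"
  "f \<oplus>\<^bsub>Hom (free_lin_cat Q) u v\<^esub> g = f + g"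
  "c \<odot>\<^bsub>Hom (free_lin_cat Q) u v\<^esub> f = Poly_Mapping.map ((*) c) f"
  "ident (free_lin_cat Q) u = Poly_Mapping.single [] 1"
  "cmp (free_lin_cat Q) u v w g f = path_conv f g"
  by (simp_all add: free_lin_cat_def)

lemma free_linear_category:
  "linear_category (free_lin_cat Q :: ('v, 'a list \<Rightarrow>\<^sub>0 'k :: field, 'k) lin_cat)"
proof (rule linear_category.intro)
  let ?C = "free_lin_cat Q :: ('v, 'a list \<Rightarrow>\<^sub>0 'k :: field, 'k) lin_cat"
  fix u v
  show "Module.module (ring_of_type_algebra :: 'k ring) (Hom ?C u v)"
  proof (rule moduleI)
    show "abelian_group (Hom ?C u v)"
    proof (rule abelian_groupI)
      fix f assume "f \<in> Mor ?C u v"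
      then show "\<exists>g \<in> Mor ?C u v. g \<oplus>\<^bsub>Hom ?C u v\<^esub> f = \<zero>\<^bsub>Hom ?C u v\<^esub>"
        by (intro bexI[of _ "- f"]) simp_all
    qed (use keys_add in \<open>fastforce simp: algebra_simps\<close>)+
  qed (use keys_map_mult in \<open>fastforce simp: cring_from_type_algebra\<close>
      | intro poly_mapping_eqI, simp add: lookup_map_mult lookup_add algebra_simps)+
next
  fix u v w and f g :: "'a list \<Rightarrow>\<^sub>0 'k"
  assume "f \<in> Mor (free_lin_cat Q) u v" "g \<in> Mor (free_lin_cat Q) v w"
  then show "cmp (free_lin_cat Q) u v w g f \<in> Mor (free_lin_cat Q) u w"
    by (auto elim!: keys_path_conv intro: pre_digraph.awalk_append)
qed (auto simp: path_conv_assoc path_conv_add path_conv_smult_left path_conv_smult_right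
    pre_digraph.awalk_def pre_digraph.cas.simps)

section \<open>Morphisms of quivers\<close>

text \<open>The pushforward along a map of arrows. As a sum it makes sense for non-injective
  \<open>\<phi>\<close> too: coefficients of paths with equal image add up. The arrow maps below are
  inverse to each other only on actual arcs.\<close>

definition relabel :: "('a \<Rightarrow> 'b) \<Rightarrow> ('a list \<Rightarrow>\<^sub>0 'k :: field) \<Rightarrow> ('b list \<Rightarrow>\<^sub>0 'k)" where
  "relabel \<phi> f
    = (\<Sum>p \<in> Poly_Mapping.keys f. Poly_Mapping.single (map \<phi> p) (Poly_Mapping.lookup f p))"

lemma relabel_zero [simp]: "relabel \<phi> 0 = 0"
  by (simp add: relabel_def)

lemma relabel_single [simp]:
  "relabel \<phi> (Poly_Mapping.single p a) = Poly_Mapping.single (map \<phi> p) a"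
  by (simp add: relabel_def)

lemma relabel_add [simp]: "relabel \<phi> (f + g) = relabel \<phi> f + relabel \<phi> g"
  unfolding relabel_def by (rule setsum_keys_plus_distrib) (simp_all add: single_add)

lemma relabel_diff [simp]: "relabel \<phi> (f - g) = relabel \<phi> f - relabel \<phi> g"
  by (metis relabel_add diff_add_cancel add_diff_cancel_right')

lemma relabel_smult:
  "relabel \<phi> (Poly_Mapping.map ((*) c) f) = Poly_Mapping.map ((*) c) (relabel \<phi> f)"
  by (induction f rule: poly_mapping_single_plus_induct) simp_all

lemma relabel_path_conv:
  "relabel \<phi> (path_conv f g) = path_conv (relabel \<phi> f) (relabel \<phi> g)"
proof (induction f rule: poly_mapping_single_plus_induct)
  case (single_plus p a f)
  have "relabel \<phi> (path_conv (Poly_Mapping.single p a) g)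
      = path_conv (relabel \<phi> (Poly_Mapping.single p a)) (relabel \<phi> g)"
    by (induction g rule: poly_mapping_single_plus_induct) (simp_all add: path_conv_add)
  with single_plus show ?case by (simp add: path_conv_add)
qed simp

lemma relabel_relabel: "relabel \<psi> (relabel \<phi> f) = relabel (\<psi> \<circ> \<phi>) f"
  by (induction f rule: poly_mapping_single_plus_induct) (simp_all add: o_def)

text \<open>The assumption concerns only the paths that occur in \<open>f\<close>, since the two
  arrow maps compose to the identity on arcs and not on the whole type.\<close>

lemma relabel_eq_self:
  assumes "\<And>p. p \<in> Poly_Mapping.keys f \<Longrightarrow> map \<phi> p = p"
  shows "relabel \<phi> f = f"
proof (rule poly_mapping_eqI)
  fix q
  have "Poly_Mapping.lookup (relabel \<phi> f) q
      = (\<Sum>p \<in> Poly_Mapping.keys f. if p = q then Poly_Mapping.lookup f p else 0)"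
    unfolding relabel_def lookup_sum
    by (intro sum.cong refl) (simp add: assms lookup_single when_def)
  also have "\<dots> = Poly_Mapping.lookup f q"
    by (simp add: in_keys_iff)
  finally show "Poly_Mapping.lookup (relabel \<phi> f) q = Poly_Mapping.lookup f q" .
qed

lemma keys_relabel: "Poly_Mapping.keys (relabel \<phi> f) \<subseteq> map \<phi> ` Poly_Mapping.keys f"
  unfolding relabel_def by (rule order.trans[OF keys_sum]) auto

definition quiver_map ::
    "('v, 'a) pre_digraph \<Rightarrow> ('w, 'b) pre_digraph \<Rightarrow> ('v \<Rightarrow> 'w) \<Rightarrow> ('a \<Rightarrow> 'b) \<Rightarrow> bool" where
  "quiver_map Q Q' \<sigma> \<phi> \<longleftrightarrow> \<sigma> ` verts Q \<subseteq> verts Q' \<and>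
    (\<forall>a \<in> arcs Q. \<phi> a \<in> arcs Q' \<and> tail Q' (\<phi> a) = \<sigma> (tail Q a) \<and> head Q' (\<phi> a) = \<sigma> (head Q a))"

lemma quiver_map_awalk:
  assumes "quiver_map Q Q' \<sigma> \<phi>" "pre_digraph.awalk Q u p v"
  shows "pre_digraph.awalk Q' (\<sigma> u) (map \<phi> p) (\<sigma> v)"
proof -
  have "pre_digraph.cas Q' (\<sigma> u) (map \<phi> p) (\<sigma> v)"
    if "set p \<subseteq> arcs Q" "pre_digraph.cas Q u p v"
    using that
  proof (induction p arbitrary: u)
    case (Cons a p)
    then show ?case using assms(1) by (auto simp: pre_digraph.cas.simps quiver_map_def)
  qed (simp add: pre_digraph.cas.simps)
  then show ?thesis
    using assms by (auto simp: pre_digraph.awalk_def quiver_map_def)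
qed

text \<open>Written exactly as the generating family in \<open>presented_lin_cat\<close>, so that
  the two agree after unfolding.\<close>

abbreviation rel_diffs ::
    "('v \<Rightarrow> 'v \<Rightarrow> ('a list \<times> 'a list) set) \<Rightarrow> 'v \<Rightarrow> 'v \<Rightarrow> ('a list \<Rightarrow>\<^sub>0 'k :: field) set" where
  "rel_diffs E \<equiv>
    (\<lambda>u v. {Poly_Mapping.single p 1 - Poly_Mapping.single q 1 | p q. (p, q) \<in> E u v})"

lemma rel_diffs_Mor:
  assumes "\<And>u v p q. (p, q) \<in> E u v
    \<Longrightarrow> pre_digraph.awalk Q u p v \<and> pre_digraph.awalk Q u q v"
  shows "rel_diffs E u v \<subseteq> Mor (free_lin_cat Q) u v"
proof -
  have "pre_digraph.awalk Q u r v"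
    if "(p, q) \<in> E u v" and
      "r \<in> Poly_Mapping.keys (Poly_Mapping.single p (1 :: 'c) - Poly_Mapping.single q 1)"
    for p q r
  proof -
    have "r = p \<or> r = q"
      using that(2) by (auto simp: in_keys_iff lookup_minus lookup_single when_def split: if_splits)
    with assms[OF that(1)] show ?thesis by auto
  qed
  then show ?thesis by auto
qed

text \<open>\<open>map_gen_ideal\<close> leaves the generators, and by linearity
  \<open>relabel\<close> sends the difference of two related paths to the difference of their
  images.\<close>

lemma quiver_map_ideal_functor:
  assumes "quiver_map Q Q' \<sigma> \<phi>"
    and E: "\<And>u v p q. (p, q) \<in> E u v
      \<Longrightarrow> pre_digraph.awalk Q u p v \<and> pre_digraph.awalk Q u q v"
    and E': "\<And>u v p q. (p, q) \<in> E' u v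
      \<Longrightarrow> pre_digraph.awalk Q' u p v \<and> pre_digraph.awalk Q' u q v"
    and EE': "\<And>u v p q. (p, q) \<in> E u v \<Longrightarrow> (map \<phi> p, map \<phi> q) \<in> E' (\<sigma> u) (\<sigma> v)"
  shows "ideal_functor (free_lin_cat Q :: (_, _, 'k :: field) lin_cat) (free_lin_cat Q')
    \<sigma> (\<lambda>u v. relabel \<phi>)
    (gen_ideal (free_lin_cat Q) (rel_diffs E)) (gen_ideal (free_lin_cat Q') (rel_diffs E'))"
proof -
  let ?C = "free_lin_cat Q :: (_, _, 'k) lin_cat"
  let ?D = "free_lin_cat Q' :: (_, _, 'k) lin_cat"
  interpret C: linear_category ?C by (rule free_linear_category)
  interpret D: linear_category ?D by (rule free_linear_category)
  interpret F: linear_functor ?C ?D \<sigma> "\<lambda>u v. relabel \<phi>"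
  proof (unfold_locales, goal_cases)
    case 1
    then show ?case using assms(1) by (auto simp: quiver_map_def)
  next
    case 2
    then show ?case using keys_relabel quiver_map_awalk[OF assms(1)] by fastforce
  qed (simp_all add: relabel_smult relabel_path_conv)
  interpret I: linear_ideal ?C "gen_ideal ?C (rel_diffs E)"
    using rel_diffs_Mor[OF E] by (intro gen_ideal_linear_ideal C.linear_category_axioms)
  interpret I': linear_ideal ?D "gen_ideal ?D (rel_diffs E')"
    using rel_diffs_Mor[OF E'] by (intro gen_ideal_linear_ideal D.linear_category_axioms)
  show ?thesis
  proof unfold_locales
    fix u v f assume "(u, v, f) \<in> gen_ideal ?C (rel_diffs E)"
    then show "(\<sigma> u, \<sigma> v, relabel \<phi> f) \<in> gen_ideal ?D (rel_diffs E')"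
      by (rule F.map_gen_ideal) (use rel_diffs_Mor[OF E] EE' in \<open>fastforce+\<close>)
  qed
qed

lemma isomorphic_presented:
  assumes maps: "quiver_map Q Q' \<sigma> \<phi>" "quiver_map Q' Q \<tau> \<psi>"
    and E: "\<And>u v p q. (p, q) \<in> E u v
      \<Longrightarrow> pre_digraph.awalk Q u p v \<and> pre_digraph.awalk Q u q v"
    and E': "\<And>u v p q. (p, q) \<in> E' u v
      \<Longrightarrow> pre_digraph.awalk Q' u p v \<and> pre_digraph.awalk Q' u q v"
    and EE': "\<And>u v p q. (p, q) \<in> E u v \<Longrightarrow> (map \<phi> p, map \<phi> q) \<in> E' (\<sigma> u) (\<sigma> v)"
    and E'E: "\<And>u v p q. (p, q) \<in> E' u v \<Longrightarrow> (map \<psi> p, map \<psi> q) \<in> E (\<tau> u) (\<tau> v)"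
    and verts_inv: "\<And>u. u \<in> verts Q \<Longrightarrow> \<tau> (\<sigma> u) = u" "\<And>u. u \<in> verts Q' \<Longrightarrow> \<sigma> (\<tau> u) = u"
    and arcs_inv: "\<And>a. a \<in> arcs Q \<Longrightarrow> \<psi> (\<phi> a) = a" "\<And>a. a \<in> arcs Q' \<Longrightarrow> \<phi> (\<psi> a) = a"
  shows "isomorphic_lin_cat (presented_lin_cat Q E :: (_, _, 'k :: field) lin_cat)
    (presented_lin_cat Q' E')"
proof -
  have F: "ideal_functor (free_lin_cat Q :: (_, _, 'k) lin_cat) (free_lin_cat Q')
      \<sigma> (\<lambda>u v. relabel \<phi>)
      (gen_ideal (free_lin_cat Q) (rel_diffs E)) (gen_ideal (free_lin_cat Q') (rel_diffs E'))"
    by (rule quiver_map_ideal_functor[OF maps(1)]) (use E E' EE' in auto)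
  have G: "ideal_functor (free_lin_cat Q' :: (_, _, 'k) lin_cat) (free_lin_cat Q)
      \<tau> (\<lambda>u v. relabel \<psi>)
      (gen_ideal (free_lin_cat Q') (rel_diffs E')) (gen_ideal (free_lin_cat Q) (rel_diffs E))"
    by (rule quiver_map_ideal_functor[OF maps(2)]) (use E E' E'E in auto)
  \<comment> \<open>All arrows of a walk are arcs of the quiver, so inverse laws on arcs
    suffice.\<close>
  have path_inv: "map (\<psi> \<circ> \<phi>) p = p" if "pre_digraph.awalk Q u p v" for u p v
    using that arcs_inv(1) by (auto simp: pre_digraph.awalk_def intro!: map_idI)
  have path_inv': "map (\<phi> \<circ> \<psi>) p = p" if "pre_digraph.awalk Q' u p v" for u p v
    using that arcs_inv(2) by (auto simp: pre_digraph.awalk_def intro!: map_idI)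
  show ?thesis
    unfolding presented_lin_cat_def
    by (rule isomorphic_quot[OF F G])
      (use verts_inv path_inv path_inv' in \<open>auto simp: relabel_relabel intro!: relabel_eq_self\<close>)
qed

section \<open>The disk quiver and the zig-zag quiver\<close>

context
  fixes n :: nat
begin

text \<open>The cutoff by \<open>{1..n - 1}\<close> matters: odd indices outside \<open>S\<close>
  are switched on, and there are infinitely many for finite \<open>S\<close>.\<close>

definition disk_to_zigzag :: "nat set \<Rightarrow> handle set" where
  "disk_to_zigzag S = H ` {i \<in> {1..n - 1}. i \<in> S \<longleftrightarrow> even i}"

text \<open>The same parity condition again, because flipping the odd indices is an
  involution.\<close>

definition zigzag_to_disk :: "handle set \<Rightarrow> nat set" where
  "zigzag_to_disk T = {i \<in> {1..n - 1}. H i \<in> T \<longleftrightarrow> even i}"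

definition disk_to_zigzag_arc :: "nat set \<times> nat \<Rightarrow> handle set \<times> handle \<times> handle" where
  "disk_to_zigzag_arc = (\<lambda>(S, p). (disk_to_zigzag S,
    if odd p then (H p, H (p + 1)) else (H (p + 1), H p)))"

text \<open>A chord joins neighbouring indices in either order, while \<open>\<theta>_p\<close> is
  named after the smaller one; hence \<open>min\<close>.\<close>

definition zigzag_to_disk_arc :: "handle set \<times> handle \<times> handle \<Rightarrow> nat set \<times> nat" where
  "zigzag_to_disk_arc = (\<lambda>(T, a, b). (zigzag_to_disk T,
    case (a, b) of (H i, H j) \<Rightarrow> min i j))"

lemma H_mem_disk_to_zigzag [simp]:
  "H i \<in> disk_to_zigzag S \<longleftrightarrow> i \<in> {1..n - 1} \<and> (i \<in> S \<longleftrightarrow> even i)"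
  by (auto simp: disk_to_zigzag_def)

lemma H_mem_handles [simp]: "H i \<in> handles n \<longleftrightarrow> i \<in> {1..n - 1}"
  by (auto simp: handles_def)

lemma handle_set_eqI: "(\<And>i. H i \<in> S \<longleftrightarrow> H i \<in> T) \<Longrightarrow> S = T"
  by (metis handle.exhaust subsetI subset_antisym)

lemma disk_to_zigzag_subset: "disk_to_zigzag S \<subseteq> handles n"
  by (auto simp: disk_to_zigzag_def)

lemma zigzag_to_disk_to_zigzag:
  assumes "T \<subseteq> handles n" shows "disk_to_zigzag (zigzag_to_disk T) = T"
  by (rule handle_set_eqI) (use assms in \<open>auto simp: zigzag_to_disk_def\<close>)

lemma disk_to_zigzag_to_disk: "S \<subseteq> {1..n - 1} \<Longrightarrow> zigzag_to_disk (disk_to_zigzag S) = S"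
  by (auto simp: zigzag_to_disk_def)

text \<open>Exactly one of \<open>p\<close>, \<open>p + 1\<close> is odd. Since both are absent from
  \<open>S\<close>, the flip makes the odd handle present and the even one absent, as a chord
  requires; once both are adjoined, the flip shows the opposite. The four facts together serve the
  quiver map, the relations and the inverse law.\<close>

lemma disk_arcE:
  assumes "(S, p) \<in> arcs (disk_quiver n)"
  obtains a b where "disk_to_zigzag_arc (S, p) = (disk_to_zigzag S, a, b)"
    "(disk_to_zigzag S, a, b) \<in> arcs (zigzag_quiver n)"
    "move a b (disk_to_zigzag S) = disk_to_zigzag (S \<union> {p, p + 1})"
    "zigzag_to_disk_arc (disk_to_zigzag S, a, b) = (S, p)"
proof -
  define a where "a = (if odd p then H p else H (p + 1))"
  define b where "b = (if odd p then H (p + 1) else H p)"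
  have p: "S \<subseteq> {1..n - 1}" "1 \<le> p" "p + 1 \<le> n - 1" "p \<notin> S" "p + 1 \<notin> S"
    using assms by (auto simp: disk_quiver_def)
  show ?thesis
  proof
    show "disk_to_zigzag_arc (S, p) = (disk_to_zigzag S, a, b)"
      by (simp add: disk_to_zigzag_arc_def a_def b_def)
    show "(disk_to_zigzag S, a, b) \<in> arcs (zigzag_quiver n)"
      using p disk_to_zigzag_subset
      by (auto simp: zigzag_quiver_def reeb_chords_def a_def b_def)
    show "move a b (disk_to_zigzag S) = disk_to_zigzag (S \<union> {p, p + 1})"
      using p by (intro handle_set_eqI) (auto simp: move_def a_def b_def)
    show "zigzag_to_disk_arc (disk_to_zigzag S, a, b) = (S, p)"
      using p(1) by (simp add: zigzag_to_disk_arc_def disk_to_zigzag_to_disk a_def b_def)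
  qed
qed

lemma zigzag_arcE:
  assumes "(T, a, b) \<in> arcs (zigzag_quiver n)"
  obtains p where "zigzag_to_disk_arc (T, a, b) = (zigzag_to_disk T, p)"
    "(zigzag_to_disk T, p) \<in> arcs (disk_quiver n)"
    "zigzag_to_disk T \<union> {p, p + 1} = zigzag_to_disk (move a b T)"
    "disk_to_zigzag_arc (zigzag_to_disk T, p) = (T, a, b)"
proof -
  obtain i j where ij: "a = H i" "b = H j" "i \<in> {1..n - 1}" "j \<in> {1..n - 1}" "odd i" "even j"
      "\<bar>int i - int j\<bar> = 1" and T: "T \<subseteq> handles n" "H i \<in> T" "H j \<notin> T"
    using assms by (auto simp: zigzag_quiver_def reeb_chords_def)
  define p where "p = min i j"
  \<comment> \<open>As \<open>i\<close> is odd and \<open>j\<close> is even, the parity of the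
    smaller index decides which end of the chord it is.\<close>
  have p: "odd p \<and> i = p \<and> j = p + 1 \<or> even p \<and> i = p + 1 \<and> j = p"
    using ij(5-7) by (cases "i \<le> j") (auto simp: p_def min_def)
  show ?thesis
  proof
    show "zigzag_to_disk_arc (T, a, b) = (zigzag_to_disk T, p)"
      by (simp add: zigzag_to_disk_arc_def ij p_def)
    show "(zigzag_to_disk T, p) \<in> arcs (disk_quiver n)"
      using p ij T by (auto simp: disk_quiver_def zigzag_to_disk_def)
    show "zigzag_to_disk T \<union> {p, p + 1} = zigzag_to_disk (move a b T)"
      using p ij T by (auto simp: zigzag_to_disk_def move_def)
    show "disk_to_zigzag_arc (zigzag_to_disk T, p) = (T, a, b)"
      using p ij T by (auto simp: disk_to_zigzag_arc_def zigzag_to_disk_to_zigzag)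
  qed
qed

lemma disk_to_zigzag_quiver_map:
  "quiver_map (disk_quiver n) (zigzag_quiver n) disk_to_zigzag disk_to_zigzag_arc"
  unfolding quiver_map_def
proof (intro conjI ballI)
  show "disk_to_zigzag ` verts (disk_quiver n) \<subseteq> verts (zigzag_quiver n)"
    using disk_to_zigzag_subset by (auto simp: zigzag_quiver_def)
  fix e assume e: "e \<in> arcs (disk_quiver n)"
  obtain S p where [simp]: "e = (S, p)" by (cases e)
  from e have "(S, p) \<in> arcs (disk_quiver n)" by simp
  then obtain a b where "disk_to_zigzag_arc (S, p) = (disk_to_zigzag S, a, b)"
    "(disk_to_zigzag S, a, b) \<in> arcs (zigzag_quiver n)"
    "move a b (disk_to_zigzag S) = disk_to_zigzag (S \<union> {p, p + 1})"
    by (rule disk_arcE)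
  then show "disk_to_zigzag_arc e \<in> arcs (zigzag_quiver n)"
    "tail (zigzag_quiver n) (disk_to_zigzag_arc e) = disk_to_zigzag (tail (disk_quiver n) e)"
    "head (zigzag_quiver n) (disk_to_zigzag_arc e) = disk_to_zigzag (head (disk_quiver n) e)"
    by (simp_all add: disk_quiver_def zigzag_quiver_def)
qed

lemma zigzag_to_disk_quiver_map:
  "quiver_map (zigzag_quiver n) (disk_quiver n) zigzag_to_disk zigzag_to_disk_arc"
  unfolding quiver_map_def
proof (intro conjI ballI)
  show "zigzag_to_disk ` verts (zigzag_quiver n) \<subseteq> verts (disk_quiver n)"
    by (auto simp: disk_quiver_def zigzag_to_disk_def)
  fix e assume e: "e \<in> arcs (zigzag_quiver n)"
  obtain T a b where [simp]: "e = (T, a, b)" by (cases e)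
  from e have "(T, a, b) \<in> arcs (zigzag_quiver n)" by simp
  then obtain p where "zigzag_to_disk_arc (T, a, b) = (zigzag_to_disk T, p)"
    "(zigzag_to_disk T, p) \<in> arcs (disk_quiver n)"
    "zigzag_to_disk T \<union> {p, p + 1} = zigzag_to_disk (move a b T)"
    by (rule zigzag_arcE)
  then show "zigzag_to_disk_arc e \<in> arcs (disk_quiver n)"
    "tail (disk_quiver n) (zigzag_to_disk_arc e) = zigzag_to_disk (tail (zigzag_quiver n) e)"
    "head (disk_quiver n) (zigzag_to_disk_arc e) = zigzag_to_disk (head (zigzag_quiver n) e)"
    by (simp_all add: disk_quiver_def zigzag_quiver_def)
qed

lemma disk_to_zigzag_relations:
  assumes "(P, P') \<in> disk_relations n S T"
  shows "(map disk_to_zigzag_arc P, map disk_to_zigzag_arc P')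
    \<in> zigzag_relations n (disk_to_zigzag S) (disk_to_zigzag T)"
proof -
  obtain p q where P: "P = [(S, p), (S \<union> {p, p + 1}, q)]" "P' = [(S, q), (S \<union> {q, q + 1}, p)]"
    and walks: "pre_digraph.awalk (disk_quiver n) S P T" "pre_digraph.awalk (disk_quiver n) S P' T"
    using assms by (auto simp: disk_relations_def)
  have arcs: "(S, p) \<in> arcs (disk_quiver n)" "(S, q) \<in> arcs (disk_quiver n)"
    using walks by (auto simp: P pre_digraph.awalk_def)
  obtain a b where ab: "disk_to_zigzag_arc (S, p) = (disk_to_zigzag S, a, b)"
    "move a b (disk_to_zigzag S) = disk_to_zigzag (S \<union> {p, p + 1})"
    using arcs(1) by (rule disk_arcE)
  obtain a' b' where ab': "disk_to_zigzag_arc (S, q) = (disk_to_zigzag S, a', b')"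
    "move a' b' (disk_to_zigzag S) = disk_to_zigzag (S \<union> {q, q + 1})"
    using arcs(2) by (rule disk_arcE)
  \<comment> \<open>The second arrow of each path starts at a different vertex than in
    \<open>ab\<close> and \<open>ab'\<close>, but its chord is the same, being read off from the
    index alone; the move equations identify its start.\<close>
  have "map disk_to_zigzag_arc P
      = [(disk_to_zigzag S, a, b), (move a b (disk_to_zigzag S), a', b')]"
    "map disk_to_zigzag_arc P'
      = [(disk_to_zigzag S, a', b'), (move a' b' (disk_to_zigzag S), a, b)]"
    using ab ab' by (simp_all add: P disk_to_zigzag_arc_def)
  then show ?thesis
    using quiver_map_awalk[OF disk_to_zigzag_quiver_map walks(1)]
      quiver_map_awalk[OF disk_to_zigzag_quiver_map walks(2)]
    unfolding zigzag_relations_def by auto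
qed

lemma zigzag_to_disk_relations:
  assumes "(P, P') \<in> zigzag_relations n S T"
  shows "(map zigzag_to_disk_arc P, map zigzag_to_disk_arc P')
    \<in> disk_relations n (zigzag_to_disk S) (zigzag_to_disk T)"
proof -
  obtain a b a' b' where P: "P = [(S, a, b), (move a b S, a', b')]"
      "P' = [(S, a', b'), (move a' b' S, a, b)]"
    and walks: "pre_digraph.awalk (zigzag_quiver n) S P T"
      "pre_digraph.awalk (zigzag_quiver n) S P' T"
    using assms by (auto simp: zigzag_relations_def)
  have arcs: "(S, a, b) \<in> arcs (zigzag_quiver n)" "(S, a', b') \<in> arcs (zigzag_quiver n)"
    using walks by (auto simp: P pre_digraph.awalk_def)
  obtain p where p: "zigzag_to_disk_arc (S, a, b) = (zigzag_to_disk S, p)"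
    "zigzag_to_disk S \<union> {p, p + 1} = zigzag_to_disk (move a b S)"
    using arcs(1) by (rule zigzag_arcE)
  obtain q where q: "zigzag_to_disk_arc (S, a', b') = (zigzag_to_disk S, q)"
    "zigzag_to_disk S \<union> {q, q + 1} = zigzag_to_disk (move a' b' S)"
    using arcs(2) by (rule zigzag_arcE)
  have "map zigzag_to_disk_arc P
      = [(zigzag_to_disk S, p), (zigzag_to_disk S \<union> {p, p + 1}, q)]"
    "map zigzag_to_disk_arc P'
      = [(zigzag_to_disk S, q), (zigzag_to_disk S \<union> {q, q + 1}, p)]"
    \<comment> \<open>The middle vertices are rewritten as images of moved sets; the indices of the
      second arrows agree because they depend only on the chords.\<close>
    using p(1) q(1) unfolding p(2) q(2) by (simp_all add: P zigzag_to_disk_arc_def)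
  then show ?thesis
    using quiver_map_awalk[OF zigzag_to_disk_quiver_map walks(1)]
      quiver_map_awalk[OF zigzag_to_disk_quiver_map walks(2)]
    unfolding disk_relations_def by auto
qed

end

theorem theorem6p13:
  fixes n :: nat
  assumes "CHAR('k :: field) = 2"
    and "n \<ge> 2"
  shows "isomorphic_lin_cat
           (disk_category n :: (_, _, 'k) lin_cat)
           (zigzag_category n :: (_, _, 'k) lin_cat)"
  unfolding disk_category_def zigzag_category_def
proof (rule isomorphic_presented[OF disk_to_zigzag_quiver_map zigzag_to_disk_quiver_map])
  show "(map (disk_to_zigzag_arc n) p, map (disk_to_zigzag_arc n) q)
      \<in> zigzag_relations n (disk_to_zigzag n u) (disk_to_zigzag n v)"
    if "(p, q) \<in> disk_relations n u v" for u v p q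
    using that by (rule disk_to_zigzag_relations)
  show "(map (zigzag_to_disk_arc n) p, map (zigzag_to_disk_arc n) q)
      \<in> disk_relations n (zigzag_to_disk n u) (zigzag_to_disk n v)"
    if "(p, q) \<in> zigzag_relations n u v" for u v p q
    using that by (rule zigzag_to_disk_relations)
  show "zigzag_to_disk_arc n (disk_to_zigzag_arc n e) = e" if "e \<in> arcs (disk_quiver n)" for e
    using that by (cases e) (auto elim: disk_arcE)
  show "disk_to_zigzag_arc n (zigzag_to_disk_arc n e) = e" if "e \<in> arcs (zigzag_quiver n)" for e
    using that by (cases e) (auto elim: zigzag_arcE)
\<comment> \<open>What remains is that related paths are parallel walks, which is part of both
  definitions of relations, and that the vertex maps are mutually inverse.\<close>
qed (auto simp: disk_relations_def zigzag_relations_def disk_quiver_def zigzag_quiver_def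
    disk_to_zigzag_to_disk zigzag_to_disk_to_zigzag)

end
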